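(* Consider an instance of stochastic set cover with perfect coverage, as defined in the context: a finite ground set $\mathcal{B}$, a finite set of items $\mathcal{A}$ with costs $C(F)\ge 0$, mutually independent random states $V(F)\sim p_F$ with marginals $q_F(e)=\Pr[e\in V(F)]$, and $\Pr\left[\bigcup_{F\in\mathcal{A}}V(F)=\mathcal{B}\right]=1$. Let $G$ be the (random) set of items evaluated by the algorithm \texttt{Greedy}, and let $O$ be the (random) set of items evaluated by an optimal algorithm, i.e. a feasible adaptive oblivious algorithm minimizing $\mathbf{E}\left[\sum_{F\in O}C(F)\right]$. Then $$\mathbf{E}\Big[\sum_{F\in G}C(F)\Big]\;\le\; H(|\mathcal{B}|)\,\mathbf{E}\Big[\sum_{F\in O}C(F)\Big],$$ where $H(n)=\sum_{k=1}^n 1/k$ is the $n$-th harmonic number. That is, \texttt{Greedy} has approximation ratio $H(|\mathcal{B}|)$.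
   Context: Stochastic set cover: we are given a finite ground set $\mathcal{B}$ and a finite set of items $\mathcal{A}$. Each item $F\in\mathcal{A}$ has a cost $C(F)\ge 0$ and a probability distribution $p_F$ on $2^{\mathcal{B}}$; the state of $F$ is a random subset $V(F)\sim p_F$, and the states of distinct items are mutually independent. Let $q_F(e)=\Pr[e\in V(F)]$ for $(F,e)\in\mathcal{A}\times\mathcal{B}$. Evaluating an item reveals its state (re-evaluating, or evaluation by different algorithms, yields the same state). An (adaptive) algorithm evaluates items one at a time, where the choice of the next item (or the decision to stop) may depend on the states of previously evaluated items. The algorithm is oblivious: conditioning on the event that an item was evaluated does not change that item's state distribution (equivalently, the decision to evaluate $F$ depends only on the states of other items). An algorithm is feasible if the set $\mathcal{S}$ of items it evaluates satisfies $\Pr\left[\bigcup_{F\in\mathcal{S}}V(F)=\bigcup_{F\in\mathcal{A}}V(F)\right]=1$; its cost is $\mathbf{E}[\sum_{F\in\mathcal{S}}C(F)]$. In the perfect-coverage variant one additionally assumes $\Pr\left[\bigcup_{F\in\mathcal{A}}V(F)=\mathcal{B}\right]=1$. Algorithm \texttt{Greedy}: set $\mathcal{A}_1=\mathcal{A}$, $\mathcal{B}_1=\mathcal{B}$. At step $i$, with residual system $(\mathcal{A}_i,\mathcal{B}_i)$ ($\mathcal{A}_i$ the items not yet evaluated, $\mathcal{B}_i$ the elements not in the state of any evaluated item): if $\mathcal{B}_i=\emptyset$, stop. Otherwise evaluate an item $F_i\in\mathcal{A}_i$ with $\sum_{e\in\mathcal{B}_i}q_F(e)>0$ minimizing $C(F)/\sum_{e\in\mathcal{B}_i}q_F(e)$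 (ties broken arbitrarily), and set $\mathcal{A}_{i+1}=\mathcal{A}_i\setminus\{F_i\}$, $\mathcal{B}_{i+1}=\mathcal{B}_i\setminus V(F_i)$. *)

theory Defs
  imports "HOL-Probability.Probability" "HOL-Probability.Product_PMF"
    "HOL-Analysis.Harmonic_Numbers"
begin

text \<open>
  An instance consists of a finite set \<open>A\<close> of items, a finite ground set \<open>B\<close>, costs \<open>C\<close>, and for
  every item \<open>F\<close> the distribution \<open>p F\<close> of its state. As \<open>B\<close> is finite, a distribution on the
  subsets of \<open>B\<close> is a \<open>pmf\<close> supported in \<open>Pow B\<close>.
\<close>

definition stochastic_set_cover ::
  "'a set \<Rightarrow> 'b set \<Rightarrow> ('a \<Rightarrow> real) \<Rightarrow> ('a \<Rightarrow> 'b set pmf) \<Rightarrow> bool" where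
  "stochastic_set_cover A B C p \<longleftrightarrow>
     finite A \<and> finite B \<and> (\<forall>F\<in>A. 0 \<le> C F) \<and> (\<forall>F\<in>A. set_pmf (p F) \<subseteq> Pow B)"

text \<open>The product distribution makes the states of distinct items mutually independent;
  outside \<open>A\<close> the state is the dummy value \<open>{}\<close>.\<close>

definition states :: "'a set \<Rightarrow> ('a \<Rightarrow> 'b set pmf) \<Rightarrow> ('a \<Rightarrow> 'b set) pmf" where
  "states A p = Pi_pmf A {} p"

definition perfect_coverage :: "'a set \<Rightarrow> 'b set \<Rightarrow> ('a \<Rightarrow> 'b set pmf) \<Rightarrow> bool" where
  "perfect_coverage A B p \<longleftrightarrow> measure_pmf.prob (states A p) {V. (\<Union>F\<in>A. V F) = B} = 1"

definition q :: "('a \<Rightarrow> 'b set pmf) \<Rightarrow> 'a \<Rightarrow> 'b \<Rightarrow> real" where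
  "q p F e = measure_pmf.prob (p F) {X. e \<in> X}"

text \<open>
  A history lists the items evaluated so far, in order, with the states they revealed. A policy maps
  a history to the next item, or to \<open>None\<close> to stop. The choice may be randomised, with fresh
  randomness in every step; deterministic policies return point masses.
\<close>

type_synonym ('a, 'b) history = "('a \<times> 'b set) list"
type_synonym ('a, 'b) policy = "('a, 'b) history \<Rightarrow> 'a option pmf"

definition evaluated :: "('a, 'b) history \<Rightarrow> 'a set" where
  "evaluated h = fst ` set h"

definition uncovered :: "'b set \<Rightarrow> ('a, 'b) history \<Rightarrow> 'b set" where
  "uncovered B h = B - \<Union> (snd ` set h)"

text \<open>Evaluating an item again would reveal the same state at no further cost, so only
  items not yet evaluated may be chosen.\<close>

definition adaptive_algorithm :: "'a set \<Rightarrow> ('a, 'b) policy \<Rightarrow> bool" where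
  "adaptive_algorithm A \<pi> \<longleftrightarrow> (\<forall>h. set_pmf (\<pi> h) \<subseteq> insert None (Some ` (A - evaluated h)))"

text \<open>\<open>run n \<pi> V h\<close> is the distribution of the history after at most \<open>n\<close> further evaluations,
  starting from \<open>h\<close>, when the realised states are \<open>V\<close>.\<close>

primrec run ::
  "nat \<Rightarrow> ('a, 'b) policy \<Rightarrow> ('a \<Rightarrow> 'b set) \<Rightarrow> ('a, 'b) history \<Rightarrow> ('a, 'b) history pmf" where
  "run 0 \<pi> V h = return_pmf h"
| "run (Suc n) \<pi> V h =
     bind_pmf (\<pi> h) (\<lambda>x. case x of
       None \<Rightarrow> return_pmf h
     | Some F \<Rightarrow> run n \<pi> V (h @ [(F, V F)]))"

text \<open>The joint distribution of the states of all items and the set of evaluated items.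
  An adaptive algorithm has stopped after \<open>card A\<close> evaluations at the latest.\<close>

definition outcome ::
  "'a set \<Rightarrow> ('a \<Rightarrow> 'b set pmf) \<Rightarrow> ('a, 'b) policy \<Rightarrow> (('a \<Rightarrow> 'b set) \<times> 'a set) pmf" where
  "outcome A p \<pi> =
     bind_pmf (states A p) (\<lambda>V. map_pmf (\<lambda>h. (V, evaluated h)) (run (card A) \<pi> V []))"

definition expected_cost ::
  "'a set \<Rightarrow> ('a \<Rightarrow> real) \<Rightarrow> ('a \<Rightarrow> 'b set pmf) \<Rightarrow> ('a, 'b) policy \<Rightarrow> real" where
  "expected_cost A C p \<pi> = measure_pmf.expectation (outcome A p \<pi>) (\<lambda>(V, S). \<Sum>F\<in>S. C F)"

definition feasible :: "'a set \<Rightarrow> ('a \<Rightarrow> 'b set pmf) \<Rightarrow> ('a, 'b) policy \<Rightarrow> bool" where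
  "feasible A p \<pi> \<longleftrightarrow>
     measure_pmf.prob (outcome A p \<pi>) {(V, S). (\<Union>F\<in>S. V F) = (\<Union>F\<in>A. V F)} = 1"

text \<open>The guard says that \<open>F\<close> is evaluated with positive probability; \<open>cond_pmf\<close> is unspecified
  otherwise.\<close>

definition oblivious :: "'a set \<Rightarrow> ('a \<Rightarrow> 'b set pmf) \<Rightarrow> ('a, 'b) policy \<Rightarrow> bool" where
  "oblivious A p \<pi> \<longleftrightarrow>
     (\<forall>F\<in>A. set_pmf (outcome A p \<pi>) \<inter> {(V, S). F \<in> S} \<noteq> {} \<longrightarrow>
        map_pmf (\<lambda>(V, S). V F) (cond_pmf (outcome A p \<pi>) {(V, S). F \<in> S}) = p F)"

definition optimal_algorithm ::
  "'a set \<Rightarrow> ('a \<Rightarrow> real) \<Rightarrow> ('a \<Rightarrow> 'b set pmf) \<Rightarrow> ('a, 'b) policy \<Rightarrow> bool" where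
  "optimal_algorithm A C p =
     is_arg_min (expected_cost A C p)
       (\<lambda>\<pi>. adaptive_algorithm A \<pi> \<and> oblivious A p \<pi> \<and> feasible A p \<pi>)"

definition greedy_candidates ::
  "'a set \<Rightarrow> 'b set \<Rightarrow> ('a \<Rightarrow> 'b set pmf) \<Rightarrow> ('a, 'b) history \<Rightarrow> 'a set" where
  "greedy_candidates A B p h = {F \<in> A - evaluated h. (\<Sum>e\<in>uncovered B h. q p F e) > 0}"

text \<open>
  Any tie-breaking rule is allowed, including a randomised or history-dependent one. Nothing is
  required of \<open>\<pi> h\<close> when some element is uncovered but there is no candidate: such a history has
  probability \<open>0\<close> under perfect coverage.
\<close>

definition greedy_algorithm ::
  "'a set \<Rightarrow> 'b set \<Rightarrow> ('a \<Rightarrow> real) \<Rightarrow> ('a \<Rightarrow> 'b set pmf) \<Rightarrow> ('a, 'b) policy \<Rightarrow> bool" where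
  "greedy_algorithm A B C p \<pi> \<longleftrightarrow>
     adaptive_algorithm A \<pi> \<and>
     (\<forall>h. (uncovered B h = {} \<longrightarrow> \<pi> h = return_pmf None) \<and>
          (uncovered B h \<noteq> {} \<and> greedy_candidates A B p h \<noteq> {} \<longrightarrow>
             set_pmf (\<pi> h) \<subseteq>
               Some ` {F. is_arg_min (\<lambda>F. C F / (\<Sum>e\<in>uncovered B h. q p F e))
                            (\<lambda>F. F \<in> greedy_candidates A B p h) F}))"

end

theory Submission imports Defs begin

text \<open>
  Given the realised states \<open>V\<close>, an optimal algorithm evaluates \<open>F\<close> with a conditional probability
  \<open>s F V\<close> that does not depend on \<open>V F\<close>, and for almost every \<open>V\<close> each element is fractionally
  covered by the weights \<open>s F V\<close> of the items \<open>F\<close> with \<open>e \<in> V F\<close>. Only these two properties matter,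
  and they survive revealing the state of one item and discarding that item.

  Suppose \<open>n\<close> elements are uncovered and the greedy rule picks \<open>F\<close> at ratio \<open>r\<close>, whose state turns
  out to be \<open>v\<close> and covers \<open>k\<close> of them. Let \<open>x\<close> be the mean of \<open>s F\<close>, and \<open>R\<close> the cost that \<open>s\<close>
  spends on the other items when \<open>F\<close> has state \<open>v\<close>. Those items have ratio at least \<open>r\<close> and cover
  at least \<open>n - x k\<close> elements on average, so \<open>R \<ge> r (n - x k)\<close>. Hence
  \<open>r k + H(n - k) R \<le> H(n) (R + x r k)\<close>. As \<open>r k\<close> has mean \<open>C F\<close>, averaging over \<open>v\<close> gives the
  induction step.
\<close>

section \<open>Expectations over finitely supported distributions\<close>

abbreviation E :: "'a pmf \<Rightarrow> ('a \<Rightarrow> real) \<Rightarrow> real" where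
  "E \<equiv> measure_pmf.expectation"

lemma expectation_mono_finite:
  assumes "finite (set_pmf M)" "\<And>x. x \<in> set_pmf M \<Longrightarrow> f x \<le> g x"
  shows "E M f \<le> E M g"
  by (intro integral_mono_AE integrable_measure_pmf_finite assms)
     (auto simp: AE_measure_pmf_iff assms)

lemma expectation_cong_pmf:
  assumes "\<And>x. x \<in> set_pmf M \<Longrightarrow> f x = g x"
  shows "E M f = E M g"
  by (intro integral_cong_AE) (auto simp: AE_measure_pmf_iff assms)

lemma expectation_le_const:
  assumes "finite (set_pmf M)" "\<And>x. x \<in> set_pmf M \<Longrightarrow> f x \<le> c"
  shows "E M f \<le> c"
  using expectation_mono_finite[of M f "\<lambda>_. c"] assms by simp

lemma const_le_expectation:
  assumes "finite (set_pmf M)" "\<And>x. x \<in> set_pmf M \<Longrightarrow> c \<le> f x"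
  shows "c \<le> E M f"
  using expectation_mono_finite[of M "\<lambda>_. c" f] assms by simp

lemma expectation_add_finite:
  "finite (set_pmf M) \<Longrightarrow> E M (\<lambda>x. f x + g x) = E M f + E M g"
  by (intro Bochner_Integration.integral_add integrable_measure_pmf_finite)

lemma expectation_diff_finite:
  "finite (set_pmf M) \<Longrightarrow> E M (\<lambda>x. f x - g x) = E M f - E M g"
  by (intro Bochner_Integration.integral_diff integrable_measure_pmf_finite)

lemma expectation_sum_finite:
  "finite (set_pmf M) \<Longrightarrow> E M (\<lambda>x. \<Sum>i\<in>I. f i x) = (\<Sum>i\<in>I. E M (f i))"
  by (intro Bochner_Integration.integral_sum integrable_measure_pmf_finite)

lemma expectation_bind_finite:
  assumes "finite (set_pmf M)" "\<And>x. x \<in> set_pmf M \<Longrightarrow> finite (set_pmf (N x))"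
  shows "E (bind_pmf M N) f = E M (\<lambda>x. E (N x) f)"
  using assms by (simp add: pmf_expectation_bind[of "set_pmf M"] integral_measure_pmf[of "set_pmf M"])

text \<open>Both sides are expectations over the product of the two distributions, drawn in either
  order.\<close>

lemma expectation_swap_finite:
  assumes "finite (set_pmf M)" "finite (set_pmf N)"
  shows "E M (\<lambda>x. E N (f x)) = E N (\<lambda>y. E M (\<lambda>x. f x y))"
proof -
  have "E M (\<lambda>x. E N (f x)) = E (bind_pmf M (\<lambda>x. bind_pmf N (\<lambda>y. return_pmf (x, y)))) (case_prod f)"
    using assms by (simp add: expectation_bind_finite)
  also have "\<dots> = E N (\<lambda>y. E M (\<lambda>x. f x y))"
    unfolding bind_commute_pmf[of M] using assms by (simp add: expectation_bind_finite)
  finally show ?thesis .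
qed

lemma finite_set_Pi_pmf:
  assumes "finite A" "\<And>F. F \<in> A \<Longrightarrow> finite (set_pmf (p F))"
  shows "finite (set_pmf (Pi_pmf A d p))"
  using assms by (simp add: set_Pi_pmf finite_PiE_dflt)

lemma Pi_pmf_remove:
  assumes "finite A" "F \<in> A"
  shows "Pi_pmf A d p = bind_pmf (p F) (\<lambda>v. map_pmf (\<lambda>V. V(F := v)) (Pi_pmf (A - {F}) d p))"
  using Pi_pmf_insert'[of "A - {F}" F d p] assms by (simp add: insert_absorb map_pmf_def)

lemma expectation_Pi_pmf_remove:
  assumes "finite A" "\<And>F. F \<in> A \<Longrightarrow> finite (set_pmf (p F))" "F \<in> A"
  shows "E (Pi_pmf A d p) f = E (p F) (\<lambda>v. E (Pi_pmf (A - {F}) d p) (\<lambda>V. f (V(F := v))))"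
  unfolding Pi_pmf_remove[OF assms(1,3)]
  using assms by (subst expectation_bind_finite) (auto intro!: finite_imageI finite_set_Pi_pmf)

text \<open>Invariance under updates at \<open>F\<close> says functionally that \<open>g\<close>
  does not look at the state of \<open>F\<close>; once that state is drawn separately,
  \<open>g\<close> factors out.\<close>

lemma expectation_Pi_pmf_indep:
  assumes "finite A" "\<And>F. F \<in> A \<Longrightarrow> finite (set_pmf (p F))" "F \<in> A"
    and "\<And>V v. g (V(F := v)) = g V"
  shows "E (Pi_pmf A d p) (\<lambda>V. g V * f (V F)) = E (Pi_pmf A d p) g * E (p F) f"
  using assms(4) by (simp add: expectation_Pi_pmf_remove[OF assms(1-3)])

lemma fun_upd_in_set_Pi_pmf:
  assumes "finite A" "F \<in> A" "v \<in> set_pmf (p F)" "V \<in> set_pmf (Pi_pmf (A - {F}) d p)"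
  shows "V(F := v) \<in> set_pmf (Pi_pmf A d p)"
  using assms by (auto simp: Pi_pmf_remove[of A F])

section \<open>Fractional covers\<close>

text \<open>The weights may depend on the realisation, and the second condition is obliviousness in
  functional form. The first two conditions range over all \<open>V\<close>, so both pass to
  \<open>reveal\<close> without side conditions.\<close>

definition fractional_cover ::
  "'a set \<Rightarrow> 'b set \<Rightarrow> ('a \<Rightarrow> 'b set pmf) \<Rightarrow> ('a \<Rightarrow> ('a \<Rightarrow> 'b set) \<Rightarrow> real) \<Rightarrow> bool" where
  "fractional_cover A B p s \<longleftrightarrow>
     (\<forall>F V. 0 \<le> s F V) \<and> (\<forall>F V v. s F (V(F := v)) = s F V) \<and>
     (\<forall>V\<in>set_pmf (states A p). \<forall>e\<in>B. 1 \<le> (\<Sum>F\<in>A. s F V * of_bool (e \<in> V F)))"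

definition fractional_cost ::
  "'a set \<Rightarrow> ('a \<Rightarrow> real) \<Rightarrow> ('a \<Rightarrow> 'b set pmf) \<Rightarrow> ('a \<Rightarrow> ('a \<Rightarrow> 'b set) \<Rightarrow> real) \<Rightarrow> real" where
  "fractional_cost A C p s = E (states A p) (\<lambda>V. \<Sum>F\<in>A. s F V * C F)"

text \<open>Draws from \<open>states (A - {F}) p\<close> hold the dummy \<open>{}\<close> at
  \<open>F\<close>; the update puts the known state back before \<open>s\<close> reads it.\<close>

definition reveal ::
  "'a \<Rightarrow> 'b set \<Rightarrow> ('a \<Rightarrow> ('a \<Rightarrow> 'b set) \<Rightarrow> real) \<Rightarrow> 'a \<Rightarrow> ('a \<Rightarrow> 'b set) \<Rightarrow> real" where
  "reveal F v s = (\<lambda>G V. s G (V(F := v)))"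

lemma finite_set_pmf_state:
  assumes "stochastic_set_cover A B C p" "F \<in> A"
  shows "finite (set_pmf (p F))"
  using assms finite_subset[of "set_pmf (p F)" "Pow B"]
  by (auto simp: stochastic_set_cover_def)

lemma finite_set_states:
  assumes "stochastic_set_cover A B C p"
  shows "finite (set_pmf (states A p))"
  using assms finite_set_pmf_state[OF assms]
  by (auto simp: states_def stochastic_set_cover_def intro: finite_set_Pi_pmf)

lemma stochastic_set_cover_mono:
  "stochastic_set_cover A B C p \<Longrightarrow> A' \<subseteq> A \<Longrightarrow> stochastic_set_cover A' B C p"
  unfolding stochastic_set_cover_def by (blast intro: finite_subset)

lemma expectation_states_remove:
  assumes "stochastic_set_cover A B C p" "F \<in> A"
  shows "E (states A p) f = E (p F) (\<lambda>v. E (states (A - {F}) p) (\<lambda>V. f (V(F := v))))"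
  using assms finite_set_pmf_state[OF assms(1)] expectation_Pi_pmf_remove[of A p F]
  by (simp add: states_def stochastic_set_cover_def)

lemma expectation_of_bool_mem: "E (p F) (\<lambda>v. of_bool (e \<in> v)) = q p F e"
proof -
  have "(\<lambda>v. of_bool (e \<in> v)) = (indicator {X. e \<in> X} :: _ \<Rightarrow> real)"
    by (auto simp: indicator_def)
  then show ?thesis by (simp add: q_def)
qed

lemma sum_of_bool_mem: "finite U \<Longrightarrow> (\<Sum>e\<in>U. of_bool (e \<in> v)) = real (card (U \<inter> v))"
  by (simp add: of_bool_def sum.If_cases Int_def)

lemma expectation_card_cover:
  assumes "stochastic_set_cover A B C p" "F \<in> A" "finite U"
  shows "E (p F) (\<lambda>v. real (card (U \<inter> v))) = (\<Sum>e\<in>U. q p F e)"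
  using assms expectation_sum_finite[OF finite_set_pmf_state[OF assms(1,2)], of "\<lambda>e v. of_bool (e \<in> v)" U]
  by (simp add: expectation_of_bool_mem sum_of_bool_mem)

text \<open>An element outside \<open>v\<close> gets nothing from \<open>F\<close>, so the other
  items alone already cover it.\<close>

lemma fractional_cover_reveal:
  assumes "fractional_cover A U p s" "finite A" "F \<in> A" "v \<in> set_pmf (p F)"
  shows "fractional_cover (A - {F}) (U - v) p (reveal F v s)"
proof -
  have "reveal F v s G (V(G := w)) = reveal F v s G V" for G V w
    using assms(1) by (cases "G = F") (auto simp: reveal_def fractional_cover_def fun_upd_twist)
  moreover have "1 \<le> (\<Sum>G\<in>A - {F}. reveal F v s G V * of_bool (e \<in> V G))"
    if "V \<in> set_pmf (states (A - {F}) p)" "e \<in> U - v" for V e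
  proof -
    let ?V = "V(F := v)"
    have "?V \<in> set_pmf (states A p)"
      using fun_upd_in_set_Pi_pmf[of A F v p V] assms that by (simp add: states_def)
    then have "1 \<le> (\<Sum>G\<in>A. s G ?V * of_bool (e \<in> ?V G))"
      using assms(1) that by (auto simp: fractional_cover_def)
    also have "\<dots> = (\<Sum>G\<in>A - {F}. s G ?V * of_bool (e \<in> ?V G))"
      using assms that by (subst sum.remove[of A F]) auto
    also have "\<dots> = (\<Sum>G\<in>A - {F}. reveal F v s G V * of_bool (e \<in> V G))"
      by (intro sum.cong) (auto simp: reveal_def)
    finally show ?thesis .
  qed
  ultimately show ?thesis
    using assms(1) by (simp add: fractional_cover_def reveal_def)
qed

section \<open>Lower bounds on the cost of a fractional cover\<close>

lemma expectation_indep_mem: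
  assumes "stochastic_set_cover A B C p" "F \<in> A" "\<And>V v. s F (V(F := v)) = s F V"
  shows "E (states A p) (\<lambda>V. s F V * of_bool (e \<in> V F)) = E (states A p) (s F) * q p F e"
  using expectation_Pi_pmf_indep[of A p F "s F" "{}" "\<lambda>v. of_bool (e \<in> v)"] assms
    finite_set_pmf_state[OF assms(1)]
  by (simp add: states_def stochastic_set_cover_def expectation_of_bool_mem)

lemma fractional_cost_eq:
  assumes "stochastic_set_cover A B C p"
  shows "fractional_cost A C p s = (\<Sum>F\<in>A. E (states A p) (s F) * C F)"
  unfolding fractional_cost_def
  using assms by (simp add: expectation_sum_finite finite_set_states)

lemma fractional_cost_nonneg:
  assumes "stochastic_set_cover A B C p" "\<And>F V. 0 \<le> s F V"
  shows "0 \<le> fractional_cost A C p s"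
  unfolding fractional_cost_eq[OF assms(1)]
  using assms by (intro sum_nonneg mult_nonneg_nonneg integral_nonneg) (auto simp: stochastic_set_cover_def)

text \<open>A price argument: by independence, an item of mean weight \<open>x\<close> adds
  \<open>x * q p F e\<close> to the expected coverage of \<open>e\<close>, and each unit of expected
  coverage costs at least \<open>r\<close> at every item.\<close>

lemma fractional_cost_ge:
  assumes inst: "stochastic_set_cover A B C p" and U: "finite U"
    and s: "\<And>F V. 0 \<le> s F V" "\<And>F V v. s F (V(F := v)) = s F V"
    and ratio: "\<And>F. F \<in> A \<Longrightarrow> r * (\<Sum>e\<in>U. q p F e) \<le> C F"
  shows "r * (\<Sum>e\<in>U. E (states A p) (\<lambda>V. \<Sum>F\<in>A. s F V * of_bool (e \<in> V F)))
           \<le> fractional_cost A C p s"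
proof -
  have fin: "finite (set_pmf (states A p))"
    by (rule finite_set_states[OF inst])
  have "r * (\<Sum>e\<in>U. E (states A p) (\<lambda>V. \<Sum>F\<in>A. s F V * of_bool (e \<in> V F)))
      = r * (\<Sum>e\<in>U. \<Sum>F\<in>A. E (states A p) (s F) * q p F e)"
    using expectation_indep_mem[OF inst, where s = s] s
    by (simp add: expectation_sum_finite[OF fin])
  also have "\<dots> = (\<Sum>F\<in>A. E (states A p) (s F) * (r * (\<Sum>e\<in>U. q p F e)))"
    by (subst sum.swap) (simp add: sum_distrib_left mult_ac)
  also have "\<dots> \<le> (\<Sum>F\<in>A. E (states A p) (s F) * C F)"
    using ratio s by (intro sum_mono mult_left_mono integral_nonneg) auto
  finally show ?thesis
    using inst by (simp add: fractional_cost_eq)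
qed

text \<open>The weight of \<open>F\<close> ignores its own state, so its share of the cost is the
  same for every revealed \<open>v\<close>.\<close>

lemma fractional_cost_remove:
  assumes inst: "stochastic_set_cover A B C p" and F: "F \<in> A"
    and s: "\<And>F V v. s F (V(F := v)) = s F V"
  shows "fractional_cost A C p s
     = E (p F) (\<lambda>v. fractional_cost (A - {F}) C p (reveal F v s)) + E (states (A - {F}) p) (s F) * C F"
proof -
  have fin: "finite A" "finite (set_pmf (p F))" "finite (set_pmf (states (A - {F}) p))"
    using inst F finite_set_pmf_state[OF inst F]
      finite_set_states[OF stochastic_set_cover_mono[OF inst, of "A - {F}"]]
    by (auto simp: stochastic_set_cover_def)
  have "fractional_cost A C p s
     = E (p F) (\<lambda>v. E (states (A - {F}) p) (\<lambda>V. (\<Sum>G\<in>A - {F}. reveal F v s G V * C G) + s F V * C F))"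
    unfolding fractional_cost_def expectation_states_remove[OF inst F]
    by (simp add: sum.remove[OF fin(1) F] reveal_def s add.commute)
  then show ?thesis
    using fin by (simp add: fractional_cost_def expectation_add_finite)
qed

text \<open>Elements of \<open>v\<close> count too: \<open>F\<close> covers them only with weight
  \<open>s F V\<close>, so the other items must supply the remaining \<open>1 - s F V\<close>. The
  demand is thus measured over \<open>U\<close> rather than \<open>U - v\<close>.\<close>

lemma fractional_cost_reveal_ge:
  assumes inst: "stochastic_set_cover A B C p" and U: "finite U"
    and s: "fractional_cover A U p s" and F: "F \<in> A" "v \<in> set_pmf (p F)" and r: "0 \<le> r"
    and ratio: "\<And>G. G \<in> A \<Longrightarrow> r * (\<Sum>e\<in>U. q p G e) \<le> C G"
  shows "r * (real (card U) - E (states (A - {F}) p) (s F) * real (card (U \<inter> v)))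
           \<le> fractional_cost (A - {F}) C p (reveal F v s)"
proof -
  let ?A = "A - {F}" and ?x = "E (states (A - {F}) p) (s F)"
  have inst': "stochastic_set_cover ?A B C p"
    using stochastic_set_cover_mono[OF inst] by blast
  have fin: "finite A" "finite (set_pmf (states ?A p))"
    using inst finite_set_states[OF inst'] by (auto simp: stochastic_set_cover_def)
  have s0: "\<And>F V. 0 \<le> s F V" and s1: "\<And>F V v. s F (V(F := v)) = s F V"
    using s by (auto simp: fractional_cover_def)
  have s': "\<And>G V. 0 \<le> reveal F v s G V"
      "\<And>G V w. reveal F v s G (V(G := w)) = reveal F v s G V"
    using fractional_cover_reveal[where F = F and v = v, OF s] fin F by (auto simp: fractional_cover_def)
  have cov: "1 - of_bool (e \<in> v) * ?x
      \<le> E (states ?A p) (\<lambda>V. \<Sum>G\<in>?A. reveal F v s G V * of_bool (e \<in> V G))" if "e \<in> U" for e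
  proof -
    have "1 - of_bool (e \<in> v) * s F V \<le> (\<Sum>G\<in>?A. reveal F v s G V * of_bool (e \<in> V G))"
      if V: "V \<in> set_pmf (states ?A p)" for V
    proof -
      let ?V = "V(F := v)"
      have "?V \<in> set_pmf (states A p)"
        using fun_upd_in_set_Pi_pmf[of A F v p V] fin F V by (simp add: states_def)
      then have "1 \<le> (\<Sum>G\<in>A. s G ?V * of_bool (e \<in> ?V G))"
        using s \<open>e \<in> U\<close> by (auto simp: fractional_cover_def)
      also have "\<dots> = s F V * of_bool (e \<in> v) + (\<Sum>G\<in>?A. reveal F v s G V * of_bool (e \<in> V G))"
        using fin F by (subst sum.remove[of A F]) (auto simp: reveal_def s1 intro!: sum.cong)
      finally show ?thesis by (simp add: mult.commute)
    qed
    then have "E (states ?A p) (\<lambda>V. 1 - of_bool (e \<in> v) * s F V)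
        \<le> E (states ?A p) (\<lambda>V. \<Sum>G\<in>?A. reveal F v s G V * of_bool (e \<in> V G))"
      by (intro expectation_mono_finite fin)
    then show ?thesis by (simp add: expectation_diff_finite fin)
  qed
  have "real (card U) - ?x * real (card (U \<inter> v)) = (\<Sum>e\<in>U. 1 - of_bool (e \<in> v) * ?x)"
    using U by (simp add: sum_subtractf sum_of_bool_mem flip: sum_distrib_right)
  also have "\<dots> \<le> (\<Sum>e\<in>U. E (states ?A p) (\<lambda>V. \<Sum>G\<in>?A. reveal F v s G V * of_bool (e \<in> V G)))"
    by (intro sum_mono cov)
  finally show ?thesis
    using fractional_cost_ge[where s = "reveal F v s" and r = r, OF inst' U s'(1,2)] ratio
      mult_left_mono[OF _ r] by (fastforce intro: order_trans)
qed

section \<open>Harmonic numbers and a single greedy step\<close>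

text \<open>The difference consists of the last \<open>k\<close> terms of the harmonic sum, each at
  least \<open>1 / n\<close>.\<close>

lemma harm_diff_ge:
  assumes "k \<le> n"
  shows "real k \<le> real n * (harm n - harm (n - k))"
proof (cases "n = 0")
  case False
  have "harm n - harm (n - k) = (\<Sum>i\<in>{1..n} - {1..n - k}. inverse (real i))"
    by (subst sum_diff) (auto simp: harm_def)
  moreover have "(\<Sum>i\<in>{1..n} - {1..n - k}. inverse (real n)) \<le> (\<Sum>i\<in>{1..n} - {1..n - k}. inverse (real i))"
    by (intro sum_mono) (auto intro!: le_imp_inverse_le)
  moreover have "card ({1..n} - {1..n - k}) = k"
    using assms by (subst card_Diff_subset) auto
  ultimately show ?thesis
    using False by (simp add: field_simps)
qed (use assms in simp)

text \<open>With \<open>d = harm n - harm (n - k)\<close>, the bound on \<open>R\<close> gives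
  \<open>d * R >= r * n * d - d * x * r * k\<close>, and \<open>harm_diff_ge\<close> makes the first
  term at least \<open>r * k\<close>. Adding \<open>harm n * x * r * k\<close> leaves the
  nonnegative surplus \<open>harm (n - k) * x * r * k\<close>.\<close>

lemma harm_step:
  fixes r R x :: real
  assumes "k \<le> n" "0 \<le> r" "0 \<le> x" "r * (real n - x * real k) \<le> R"
  shows "r * real k + harm (n - k) * R \<le> harm n * (R + x * r * real k)"
proof -
  let ?d = "harm n - harm (n - k) :: real"
  have d: "real k \<le> real n * ?d"
    using harm_diff_ge assms by blast
  have "0 \<le> ?d"
    using harm_mono[of "n - k" n] by simp
  then have "?d * (r * (real n - x * real k)) \<le> ?d * R"
    using assms by (intro mult_left_mono)
  moreover have "r * real k \<le> r * (real n * ?d)"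
    using d assms by (intro mult_left_mono)
  moreover have "0 \<le> harm (n - k) * (x * r * real k)"
    using assms harm_nonneg[of "n - k", where 'a = real] by simp
  ultimately show ?thesis by (simp add: algebra_simps)
qed

lemma greedy_step:
  assumes inst: "stochastic_set_cover A B C p" and U: "finite U"
    and s: "fractional_cover A U p s" and F: "F \<in> A" and pos: "0 < (\<Sum>e\<in>U. q p F e)"
    and min: "\<And>G. G \<in> A \<Longrightarrow> 0 < (\<Sum>e\<in>U. q p G e) \<Longrightarrow>
      C F / (\<Sum>e\<in>U. q p F e) \<le> C G / (\<Sum>e\<in>U. q p G e)"
  shows "C F + E (p F) (\<lambda>v. harm (card (U - v)) * fractional_cost (A - {F}) C p (reveal F v s))
           \<le> harm (card U) * fractional_cost A C p s"
proof -
  define r where "r = C F / (\<Sum>e\<in>U. q p F e)"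
  define x where "x = E (states (A - {F}) p) (s F)"
  define R where "R v = fractional_cost (A - {F}) C p (reveal F v s)" for v
  let ?k = "\<lambda>v. card (U \<inter> v)"
  have fin: "finite (set_pmf (p F))"
    by (rule finite_set_pmf_state[OF inst F])
  have C0: "\<And>G. G \<in> A \<Longrightarrow> 0 \<le> C G"
    using inst by (auto simp: stochastic_set_cover_def)
  have s0: "\<And>F V. 0 \<le> s F V" and s1: "\<And>F V v. s F (V(F := v)) = s F V"
    using s by (auto simp: fractional_cover_def)
  have r0: "0 \<le> r" and x0: "0 \<le> x"
    using C0[OF F] pos s0 by (auto simp: r_def x_def intro: integral_nonneg)
  \<comment> \<open>The product form also includes items without expected coverage, which the greedy
    minimum does not compare; for them it reads \<open>0 <= C G\<close>.\<close>
  have ratio: "r * (\<Sum>e\<in>U. q p G e) \<le> C G" if "G \<in> A" for G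
  proof (cases "0 < (\<Sum>e\<in>U. q p G e)")
    case True
    with min[OF that True] show ?thesis by (simp add: r_def[symmetric] pos_le_divide_eq)
  next
    case False
    moreover have "0 \<le> (\<Sum>e\<in>U. q p G e)"
      by (intro sum_nonneg) (simp add: q_def)
    ultimately have "(\<Sum>e\<in>U. q p G e) = 0" by linarith
    then show ?thesis using C0[OF that] by simp
  qed
  have CF: "E (p F) (\<lambda>v. r * real (?k v)) = C F"
    using pos by (simp add: expectation_card_cover[OF inst F U] r_def)
  have step: "r * real (?k v) + harm (card (U - v)) * R v \<le> harm (card U) * (R v + x * (r * real (?k v)))"
    if "v \<in> set_pmf (p F)" for v
  proof -
    have "?k v \<le> card U" "card (U - v) = card U - ?k v"
      using U by (simp_all add: card_mono card_Diff_subset_Int)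
    then show ?thesis
      using harm_step[of "?k v" "card U" r x "R v"] r0 x0
        fractional_cost_reveal_ge[OF inst U s F that r0 ratio]
      by (simp add: x_def R_def mult.assoc)
  qed
  have "C F + E (p F) (\<lambda>v. harm (card (U - v)) * R v)
      = E (p F) (\<lambda>v. r * real (?k v) + harm (card (U - v)) * R v)"
    by (simp only: CF expectation_add_finite[OF fin])
  also have "\<dots> \<le> E (p F) (\<lambda>v. harm (card U) * (R v + x * (r * real (?k v))))"
    by (intro expectation_mono_finite fin step)
  also have "\<dots> = harm (card U) * (E (p F) R + x * C F)"
    unfolding CF[symmetric] by (simp add: expectation_add_finite[OF fin])
  also have "\<dots> = harm (card U) * fractional_cost A C p s"
    unfolding fractional_cost_remove[OF inst F s1] by (simp add: R_def[abs_def] x_def)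
  finally show ?thesis by (simp only: R_def)
qed

section \<open>Runs of policies\<close>

lemma evaluated_Nil [simp]: "evaluated [] = {}"
  by (simp add: evaluated_def)

lemma evaluated_append [simp]: "evaluated (h @ [(F, v)]) = insert F (evaluated h)"
  by (simp add: evaluated_def)

lemma uncovered_Nil [simp]: "uncovered B [] = B"
  by (simp add: uncovered_def)

lemma uncovered_append [simp]: "uncovered B (h @ [(F, v)]) = uncovered B h - v"
  by (auto simp: uncovered_def)

lemma adaptive_choice:
  "adaptive_algorithm A \<pi> \<Longrightarrow> Some F \<in> set_pmf (\<pi> h) \<Longrightarrow> F \<in> A - evaluated h"
  by (fastforce simp: adaptive_algorithm_def)

lemma finite_set_policy:
  assumes "adaptive_algorithm A \<pi>" "finite A"
  shows "finite (set_pmf (\<pi> h))"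
  using assms by (intro finite_subset[of "set_pmf (\<pi> h)" "insert None (Some ` (A - evaluated h))"])
    (auto simp: adaptive_algorithm_def)

lemma finite_set_run:
  assumes "adaptive_algorithm A \<pi>" "finite A"
  shows "finite (set_pmf (run n \<pi> V h))"
proof (induction n arbitrary: h)
  case (Suc n)
  then show ?case
    by (auto simp: finite_set_policy[OF assms] split: option.split)
qed simp

lemma evaluated_run_mono: "h' \<in> set_pmf (run n \<pi> V h) \<Longrightarrow> evaluated h \<subseteq> evaluated h'"
proof (induction n arbitrary: h)
  case (Suc n)
  from Suc.prems obtain x where "x \<in> set_pmf (\<pi> h)"
    "h' \<in> set_pmf (case x of None \<Rightarrow> return_pmf h | Some F \<Rightarrow> run n \<pi> V (h @ [(F, V F)]))"
    by auto
  then show ?case using Suc.IH by (fastforce split: option.splits)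
qed simp

lemma evaluated_run_subset:
  assumes "adaptive_algorithm A \<pi>"
  shows "h' \<in> set_pmf (run n \<pi> V h) \<Longrightarrow> evaluated h \<subseteq> A \<Longrightarrow> evaluated h' \<subseteq> A"
proof (induction n arbitrary: h)
  case (Suc n)
  from Suc.prems obtain x where "x \<in> set_pmf (\<pi> h)"
    "h' \<in> set_pmf (case x of None \<Rightarrow> return_pmf h | Some F \<Rightarrow> run n \<pi> V (h @ [(F, V F)]))"
    by auto
  then show ?case using Suc.IH Suc.prems adaptive_choice[OF assms]
    by (fastforce split: option.splits)
qed simp

text \<open>An adaptive algorithm never selects \<open>F\<close> a second time, so its state is not
  read again.\<close>

lemma run_fun_upd_evaluated:
  assumes "adaptive_algorithm A \<pi>"
  shows "F \<in> evaluated h \<Longrightarrow> run n \<pi> (V(F := v)) h = run n \<pi> V h"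
proof (induction n arbitrary: h)
  case (Suc n)
  then show ?case
    using adaptive_choice[OF assms]
    by (auto intro!: bind_pmf_cong split: option.split)
qed simp

lemma expectation_run_Suc:
  assumes "adaptive_algorithm A \<pi>" "finite A"
  shows "E (run (Suc n) \<pi> V h) f =
    E (\<pi> h) (\<lambda>x. case x of None \<Rightarrow> f h | Some F \<Rightarrow> E (run n \<pi> V (h @ [(F, V F)])) f)"
  unfolding run.simps
  by (subst expectation_bind_finite)
     (auto simp: finite_set_policy[OF assms] finite_set_run[OF assms] intro!: expectation_cong_pmf
       split: option.split)

text \<open>The state of \<open>F\<close> can influence the run only after \<open>F\<close> has been evaluated: every adaptive
  algorithm is oblivious.\<close>

lemma prob_evaluated_fun_upd:
  assumes "adaptive_algorithm A \<pi>" "finite A"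
  shows "E (run n \<pi> (V(F := v)) h) (\<lambda>h'. of_bool (F \<in> evaluated h'))
       = E (run n \<pi> V h) (\<lambda>h'. of_bool (F \<in> evaluated h'))"
proof (induction n arbitrary: h)
  case (Suc n)
  \<comment> \<open>Once \<open>F\<close> is chosen, its membership in the final set is certain
    whatever it reveals. This settles the only branch where the two runs see different
    states.\<close>
  have eval: "E (run n \<pi> W (h @ [(F, w)])) (\<lambda>h'. of_bool (F \<in> evaluated h')) = 1" for W w
  proof -
    have "E (run n \<pi> W (h @ [(F, w)])) (\<lambda>h'. of_bool (F \<in> evaluated h'))
        = E (run n \<pi> W (h @ [(F, w)])) (\<lambda>_. 1)"
      by (intro expectation_cong_pmf) (auto dest!: evaluated_run_mono)
    then show ?thesis by simp
  qed
  have "E (run n \<pi> (V(F := v)) (h @ [(G, (V(F := v)) G)])) (\<lambda>h'. of_bool (F \<in> evaluated h'))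
      = E (run n \<pi> V (h @ [(G, V G)])) (\<lambda>h'. of_bool (F \<in> evaluated h'))" for G
    by (cases "G = F") (simp_all add: eval Suc.IH)
  then show ?case
    unfolding expectation_run_Suc[OF assms] by simp
qed simp

section \<open>Evaluation probabilities as a fractional cover\<close>

lemma expected_cost_eq:
  assumes "stochastic_set_cover A B C p" "adaptive_algorithm A \<pi>"
  shows "expected_cost A C p \<pi>
    = E (states A p) (\<lambda>V. E (run (card A) \<pi> V []) (\<lambda>h. \<Sum>F\<in>evaluated h. C F))"
  using assms finite_set_states[OF assms(1)]
  by (simp add: expected_cost_def outcome_def expectation_bind_finite finite_set_run stochastic_set_cover_def)

text \<open>A conditional probability given all states: only the coin tosses of the policy remain
  random.\<close>

definition evaluation_prob ::
  "'a set \<Rightarrow> ('a, 'b) policy \<Rightarrow> 'a \<Rightarrow> ('a \<Rightarrow> 'b set) \<Rightarrow> real" where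
  "evaluation_prob A \<pi> F V = E (run (card A) \<pi> V []) (\<lambda>h. of_bool (F \<in> evaluated h))"

lemma expected_cost_eq_fractional_cost:
  assumes "stochastic_set_cover A B C p" "adaptive_algorithm A \<pi>"
  shows "expected_cost A C p \<pi> = fractional_cost A C p (evaluation_prob A \<pi>)"
proof -
  have A: "finite A" using assms(1) by (simp add: stochastic_set_cover_def)
  have "E (run (card A) \<pi> V []) (\<lambda>h. \<Sum>F\<in>evaluated h. C F)
      = (\<Sum>F\<in>A. evaluation_prob A \<pi> F V * C F)" for V
  proof -
    have "(\<Sum>F\<in>evaluated h. C F) = (\<Sum>F\<in>A. of_bool (F \<in> evaluated h) * C F)"
      if "h \<in> set_pmf (run (card A) \<pi> V [])" for h
    proof -
      have "evaluated h \<subseteq> A" using evaluated_run_subset[OF assms(2) that] by simp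
      then have "A \<inter> evaluated h = evaluated h" by blast
      then show ?thesis using A by simp
    qed
    then have "E (run (card A) \<pi> V []) (\<lambda>h. \<Sum>F\<in>evaluated h. C F)
      = E (run (card A) \<pi> V []) (\<lambda>h. \<Sum>F\<in>A. of_bool (F \<in> evaluated h) * C F)"
      by (rule expectation_cong_pmf)
    also have "\<dots> = (\<Sum>F\<in>A. evaluation_prob A \<pi> F V * C F)"
      by (subst expectation_sum_finite) (simp_all add: finite_set_run[OF assms(2) A] evaluation_prob_def)
    finally show ?thesis .
  qed
  then show ?thesis
    by (simp add: expected_cost_eq[OF assms] fractional_cost_def)
qed

text \<open>For discrete distributions, feasibility and perfect coverage hold at each point of the
  support, so every possible run evaluates an item covering \<open>e\<close>; averaging over the
  runs gives fractional coverage.\<close>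

lemma fractional_cover_evaluation_prob:
  assumes inst: "stochastic_set_cover A B C p" and perf: "perfect_coverage A B p"
    and adap: "adaptive_algorithm A \<pi>" and feas: "feasible A p \<pi>"
  shows "fractional_cover A B p (evaluation_prob A \<pi>)"
proof -
  have A: "finite A" using inst by (simp add: stochastic_set_cover_def)
  have "1 \<le> (\<Sum>F\<in>A. evaluation_prob A \<pi> F V * of_bool (e \<in> V F))"
    if V: "V \<in> set_pmf (states A p)" and e: "e \<in> B" for V e
  proof -
    let ?M = "run (card A) \<pi> V []"
    have cov: "(\<Union>F\<in>A. V F) = B"
      using perf V by (auto simp: perfect_coverage_def measure_pmf.prob_eq_1 AE_measure_pmf_iff)
    have "1 \<le> (\<Sum>F\<in>A. of_bool (F \<in> evaluated h) * of_bool (e \<in> V F) :: real)"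
      if h: "h \<in> set_pmf ?M" for h
    proof -
      have "(\<Union>F\<in>evaluated h. V F) = (\<Union>F\<in>A. V F)"
        using feas V h
        by (fastforce simp: feasible_def measure_pmf.prob_eq_1 AE_measure_pmf_iff outcome_def)
      then obtain F where F: "F \<in> evaluated h" "e \<in> V F" using cov e by blast
      moreover have "F \<in> A" using evaluated_run_subset[OF adap h] F by auto
      ultimately show ?thesis
        using A by (subst sum.remove[of A F]) (auto intro!: sum_nonneg)
    qed
    then have "1 \<le> E ?M (\<lambda>h. \<Sum>F\<in>A. of_bool (F \<in> evaluated h) * of_bool (e \<in> V F))"
      by (intro const_le_expectation finite_set_run[OF adap A])
    also have "\<dots> = (\<Sum>F\<in>A. evaluation_prob A \<pi> F V * of_bool (e \<in> V F))"
      by (subst expectation_sum_finite) (simp_all add: finite_set_run[OF adap A] evaluation_prob_def)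
    finally show ?thesis .
  qed
  then show ?thesis
    using prob_evaluated_fun_upd[OF adap A]
    by (auto simp: fractional_cover_def evaluation_prob_def intro: integral_nonneg)
qed

section \<open>The greedy algorithm against a fractional cover\<close>

text \<open>The fractional cover certifies that some remaining item can still contain an uncovered
  element. This excludes the histories at which \<open>greedy_algorithm\<close> leaves the choice
  open.\<close>

lemma greedy_candidates_nonempty:
  assumes inst: "stochastic_set_cover A B C p"
    and s: "fractional_cover (A - evaluated h) (uncovered B h) p s" and U: "uncovered B h \<noteq> {}"
  shows "greedy_candidates A B p h \<noteq> {}"
proof -
  obtain e where e: "e \<in> uncovered B h" using U by blast
  obtain V where V: "V \<in> set_pmf (states (A - evaluated h) p)"
    using set_pmf_not_empty by fast
  have "1 \<le> (\<Sum>F\<in>A - evaluated h. s F V * of_bool (e \<in> V F))"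
    using s e V by (auto simp: fractional_cover_def)
  \<comment> \<open>If no remaining item contained \<open>e\<close>, every term would vanish and the
    sum could not reach 1.\<close>
  then obtain F where F: "F \<in> A - evaluated h" "e \<in> V F"
    using sum.neutral[of "A - evaluated h" "\<lambda>F. s F V * of_bool (e \<in> V F)"] by fastforce
  have "V F \<in> set_pmf (p F)"
    using V F inst by (auto simp: states_def stochastic_set_cover_def set_Pi_pmf PiE_dflt_def)
  then have "0 < q p F e"
    using F by (auto simp: q_def intro: measure_pmf_posI)
  also have "q p F e \<le> (\<Sum>e\<in>uncovered B h. q p F e)"
    using e inst by (intro member_le_sum) (auto simp: q_def uncovered_def stochastic_set_cover_def)
  finally show ?thesis using F by (auto simp: greedy_candidates_def)
qed

text \<open>The invariant is a fractional cover of the residual instance, replaced by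
  \<open>reveal F v s\<close> after each evaluation. States are drawn for unevaluated items only, as
  the run reads no others.\<close>

lemma greedy_run_cost_le:
  assumes inst: "stochastic_set_cover A B C p" and greedy: "greedy_algorithm A B C p \<pi>"
  shows "evaluated h \<subseteq> A \<Longrightarrow> fractional_cover (A - evaluated h) (uncovered B h) p s \<Longrightarrow>
    E (states (A - evaluated h) p) (\<lambda>V. E (run n \<pi> V h) (\<lambda>h. \<Sum>F\<in>evaluated h. C F))
      \<le> (\<Sum>F\<in>evaluated h. C F)
         + harm (card (uncovered B h)) * fractional_cost (A - evaluated h) C p s"
proof (induction n arbitrary: h s)
  \<comment> \<open>Stopping, or exhausting the step budget, leaves just the accrued cost, so
    nonnegativity of the other term suffices there.\<close>
  have bound: "0 \<le> harm (card (uncovered B h)) * fractional_cost (A - evaluated h) C p s"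
    if "fractional_cover (A - evaluated h) (uncovered B h) p s" for h s
    using that fractional_cost_nonneg[OF stochastic_set_cover_mono[OF inst], of "A - evaluated h" s]
    by (auto simp: fractional_cover_def intro: mult_nonneg_nonneg harm_nonneg)
  {
    case 0
    then show ?case using bound by simp
  next
    case (Suc n)
    let ?A = "A - evaluated h" and ?U = "uncovered B h"
    let ?c = "\<lambda>h. \<Sum>F\<in>evaluated h. C F"
    have A: "finite A" and adap: "adaptive_algorithm A \<pi>" and U: "finite ?U"
      using inst greedy by (auto simp: stochastic_set_cover_def greedy_algorithm_def uncovered_def)
    have fin_h: "finite (evaluated h)" using Suc.prems A finite_subset by blast
    have inst': "stochastic_set_cover ?A B C p"
      using stochastic_set_cover_mono[OF inst] by blast
    have step: "(case x of None \<Rightarrow> ?c h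
        | Some F \<Rightarrow> E (states ?A p) (\<lambda>V. E (run n \<pi> V (h @ [(F, V F)])) ?c))
       \<le> ?c h + harm (card ?U) * fractional_cost ?A C p s" if x: "x \<in> set_pmf (\<pi> h)" for x
    proof (cases x)
      case None
      then show ?thesis using bound[OF Suc.prems(2)] by simp
    next
      case (Some F)
      have "?U \<noteq> {}"
        using greedy x Some by (auto simp: greedy_algorithm_def)
      then have am: "is_arg_min (\<lambda>F. C F / (\<Sum>e\<in>?U. q p F e)) (\<lambda>F. F \<in> greedy_candidates A B p h) F"
        using greedy x Some greedy_candidates_nonempty[OF inst Suc.prems(2)]
        unfolding greedy_algorithm_def by blast
      then have F: "F \<in> ?A" and pos: "0 < (\<Sum>e\<in>?U. q p F e)"
        by (auto simp: is_arg_min_def greedy_candidates_def)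
      have min: "C F / (\<Sum>e\<in>?U. q p F e) \<le> C G / (\<Sum>e\<in>?U. q p G e)"
        if "G \<in> ?A" "0 < (\<Sum>e\<in>?U. q p G e)" for G
        using am that unfolding is_arg_min_def greedy_candidates_def by (auto simp: not_less)
      have fin: "finite (set_pmf (p F))"
        by (rule finite_set_pmf_state[OF inst' F])
      have IH: "E (states (?A - {F}) p) (\<lambda>V. E (run n \<pi> V (h @ [(F, v)])) ?c)
          \<le> (?c h + C F) + harm (card (?U - v)) * fractional_cost (?A - {F}) C p (reveal F v s)"
        if "v \<in> set_pmf (p F)" for v
        using Suc.IH[of "h @ [(F, v)]" "reveal F v s"] Suc.prems F A fin_h
          fractional_cover_reveal[OF Suc.prems(2) _ F that]
        by (simp add: Diff_insert[of A F] add.commute)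
      \<comment> \<open>The state of \<open>F\<close> is drawn first; with \<open>F\<close> in the
        history, the run does not read it again and the update of \<open>V\<close>
        disappears.\<close>
      have "E (states ?A p) (\<lambda>V. E (run n \<pi> V (h @ [(F, V F)])) ?c)
          = E (p F) (\<lambda>v. E (states (?A - {F}) p) (\<lambda>V. E (run n \<pi> V (h @ [(F, v)])) ?c))"
        by (simp add: expectation_states_remove[OF inst' F] run_fun_upd_evaluated[OF adap])
      also have "\<dots> \<le> E (p F) (\<lambda>v. (?c h + C F)
          + harm (card (?U - v)) * fractional_cost (?A - {F}) C p (reveal F v s))"
        by (intro expectation_mono_finite fin IH)
      also have "\<dots> = ?c h + (C F
          + E (p F) (\<lambda>v. harm (card (?U - v)) * fractional_cost (?A - {F}) C p (reveal F v s)))"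
        by (simp add: expectation_add_finite[OF fin])
      also have "\<dots> \<le> ?c h + harm (card ?U) * fractional_cost ?A C p s"
        by (intro add_left_mono greedy_step[OF inst' U Suc.prems(2) F pos min])
      finally show ?thesis using Some by simp
    qed
    \<comment> \<open>The choice depends on the history alone, so swapping the expectations fixes
      the chosen item before the states are drawn.\<close>
    have "E (states ?A p) (\<lambda>V. E (run (Suc n) \<pi> V h) ?c)
        = E (\<pi> h) (\<lambda>x. E (states ?A p) (\<lambda>V. case x of None \<Rightarrow> ?c h
            | Some F \<Rightarrow> E (run n \<pi> V (h @ [(F, V F)])) ?c))"
      unfolding expectation_run_Suc[OF adap A]
      by (rule expectation_swap_finite[OF finite_set_states[OF inst'] finite_set_policy[OF adap A]])
    also have "\<dots> \<le> ?c h + harm (card ?U) * fractional_cost ?A C p s"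
    proof (rule expectation_le_const[OF finite_set_policy[OF adap A]])
      fix x assume "x \<in> set_pmf (\<pi> h)"
      from step[OF this] show "E (states ?A p) (\<lambda>V. case x of None \<Rightarrow> ?c h
            | Some F \<Rightarrow> E (run n \<pi> V (h @ [(F, V F)])) ?c)
          \<le> ?c h + harm (card ?U) * fractional_cost ?A C p s"
        by (cases x) simp_all
    qed
    finally show ?case .
  }
qed

theorem theorem1:
  fixes A :: "'a set" and B :: "'b set" and C :: "'a \<Rightarrow> real" and p :: "'a \<Rightarrow> 'b set pmf"
    and G Opt :: "('a, 'b) policy"
  assumes "stochastic_set_cover A B C p"
    and "perfect_coverage A B p"
    and "greedy_algorithm A B C p G"
    and "optimal_algorithm A C p Opt"
  shows "expected_cost A C p G \<le> harm (card B) * expected_cost A C p Opt"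
proof -
  have opt: "adaptive_algorithm A Opt" "feasible A p Opt"
    using assms(4) by (auto simp: optimal_algorithm_def is_arg_min_def)
  have "adaptive_algorithm A G"
    using assms(3) by (simp add: greedy_algorithm_def)
  \<comment> \<open>At the empty history the residual instance is the original one, and the cover
    given by the evaluation probabilities of \<open>Opt\<close> costs exactly what
    \<open>Opt\<close> does.\<close>
  then show ?thesis
    using greedy_run_cost_le[OF assms(1,3), of "[]" "evaluation_prob A Opt" "card A"]
      fractional_cover_evaluation_prob[OF assms(1,2) opt]
    by (simp add: expected_cost_eq[OF assms(1)] flip: expected_cost_eq_fractional_cost[OF assms(1) opt(1)])
qed

end
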